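(* Let $\overline{x}\in S=\{x\in\mathbb{R}^N : \|x\|_0\le s\}$ and let $\Gamma=\mathrm{supp}(\overline{x})$. Then the Bouligand tangent cone of $S$ at $\overline{x}$ and the corresponding normal cone are $$T^B_S(\overline{x})=\{d\in\mathbb{R}^N : \|d\|_0\le s,\ \|\overline{x}+\mu d\|_0\le s\ \ \forall \mu\in\mathbb{R}\}=\bigcup_{\Upsilon\supseteq\Gamma,\ |\Upsilon|\le s}\mathrm{span}\{e_i : i\in\Upsilon\},$$ where the union is over index sets $\Upsilon\subseteq\{1,\dots,N\}$, and $$N^B_S(\overline{x})=\begin{cases}\{d\in\mathbb{R}^N : d_i=0,\ i\in\Gamma\}=\mathrm{span}\{e_i : i\notin\Gamma\}, & \text{if } |\Gamma|=s,\\ \{0\}, & \text{if } |\Gamma|<s.\end{cases}$$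
   Context: $N$ and $s$ are positive integers with $s<N$. For $x\in\mathbb{R}^N$, $\mathrm{supp}(x)=\{i\in\{1,\dots,N\} : x_i\neq0\}$ and $\|x\|_0=|\mathrm{supp}(x)|$. $e_i\in\mathbb{R}^N$ is the $i$-th standard basis vector. For a nonempty set $\Omega\subseteq\mathbb{R}^N$ and $\overline{x}\in\Omega$, the Bouligand tangent cone is $$T^B_\Omega(\overline{x})=\Big\{d\in\mathbb{R}^N : \exists \{x^k\}\subset\Omega,\ \lim_{k\to\infty}x^k=\overline{x},\ \lambda_k\ge0\ (k=1,2,\dots),\ \text{such that } \lim_{k\to\infty}\lambda_k(x^k-\overline{x})=d\Big\},$$ and the corresponding normal cone is $N^B_\Omega(\overline{x})=\{d\in\mathbb{R}^N : \langle d,z\rangle\le0\ \ \forall z\in T^B_\Omega(\overline{x})\}$. *)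

theory Defs
  imports "HOL-Analysis.Analysis"
begin

definition vec_supp :: "real ^ 'n \<Rightarrow> 'n set" where
  "vec_supp x = {i. x $ i \<noteq> 0}"

definition l0_norm :: "real ^ 'n \<Rightarrow> nat" where
  "l0_norm x = card (vec_supp x)"

definition sparse_set :: "nat \<Rightarrow> (real ^ 'n) set" where
  "sparse_set s = {x. l0_norm x \<le> s}"

(* Meant for xbar in Omega. *)
definition bouligand_tangent_cone :: "(real ^ 'n) set \<Rightarrow> real ^ 'n \<Rightarrow> (real ^ 'n) set" where
  "bouligand_tangent_cone \<Omega> xbar =
     {d. \<exists>(x :: nat \<Rightarrow> real ^ 'n) (lam :: nat \<Rightarrow> real).
           (\<forall>k. x k \<in> \<Omega>) \<and> x \<longlonglongrightarrow> xbar \<and> (\<forall>k. 0 \<le> lam k) \<and>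
           (\<lambda>k. lam k *\<^sub>R (x k - xbar)) \<longlonglongrightarrow> d}"

definition bouligand_normal_cone :: "(real ^ 'n) set \<Rightarrow> real ^ 'n \<Rightarrow> (real ^ 'n) set" where
  "bouligand_normal_cone \<Omega> xbar =
     {d. \<forall>z \<in> bouligand_tangent_cone \<Omega> xbar. d \<bullet> z \<le> 0}"

end

theory Submission
  imports Defs
begin

text \<open>A vector \<open>d\<close> is tangent iff \<open>supp xbar \<union> supp d\<close> has at most \<open>s\<close> elements: along
  an approximating sequence \<open>x k\<close>, the coordinates in \<open>supp xbar\<close> and in \<open>supp d\<close> are eventually
  all nonzero, and conversely \<open>xbar + d / k\<close> stays in the sparse set. The normal cone is then the
  polar of a union of coordinate subspaces, which cover all coordinate axes iff \<open>|supp xbar| < s\<close>.\<close>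

text \<open>Turns each span of the theorem into a support condition, so that the identities between
  spans reduce to inclusions of finite index sets.\<close>

lemma span_axis_eq:
  "span {axis i (1::real) | i. i \<in> U} = {d :: real ^ 'n. vec_supp d \<subseteq> U}"
proof -
  have "span {axis i (1::real) :: real ^ 'n | i. i \<in> U}
      = {d. \<forall>b\<in>Basis. b \<notin> {axis i (1::real) | i. i \<in> U} \<longrightarrow> d \<bullet> b = 0}"
    by (rule span_substd_basis) (auto simp: Basis_vec_def)
  also have "\<dots> = {d. vec_supp d \<subseteq> U}"
    by (auto simp: Basis_vec_def vec_supp_def inner_axis axis_eq_axis)
  finally show ?thesis .
qed

lemma mem_bouligand_tangent_coneI:
  assumes "\<And>t. 0 < t \<Longrightarrow> xbar + t *\<^sub>R d \<in> \<Omega>"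
  shows "d \<in> bouligand_tangent_cone \<Omega> xbar"
proof -
  \<comment> \<open>Paired with the multipliers \<open>real (Suc k)\<close>, these points make the
    scaled differences constantly \<open>d\<close>; \<open>Suc\<close> keeps the step positive at
    \<open>k = 0\<close>.\<close>
  define x where "x = (\<lambda>k::nat. xbar + inverse (real (Suc k)) *\<^sub>R d)"
  have "x \<longlonglongrightarrow> xbar + 0 *\<^sub>R d"
    unfolding x_def by (intro tendsto_intros LIMSEQ_inverse_real_of_nat)
  moreover have "(\<lambda>k. real (Suc k) *\<^sub>R (x k - xbar)) \<longlonglongrightarrow> d"
    by (simp add: x_def)
  moreover have "x k \<in> \<Omega>" for k
    unfolding x_def by (intro assms) simp
  ultimately show ?thesis
    unfolding bouligand_tangent_cone_def
    by (intro CollectI exI[of _ x] exI[of _ "\<lambda>k. real (Suc k)"]) simp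
qed

lemma bouligand_tangent_cone_sparse_set_supp:
  fixes xbar d :: "real ^ 'n"
  assumes "d \<in> bouligand_tangent_cone (sparse_set s) xbar"
  shows "card (vec_supp xbar \<union> vec_supp d) \<le> s"
proof -
  from assms obtain x lam where x: "\<And>k. x k \<in> sparse_set s"
    and lim: "x \<longlonglongrightarrow> xbar" "(\<lambda>k. lam k *\<^sub>R (x k - xbar)) \<longlonglongrightarrow> d"
    unfolding bouligand_tangent_cone_def by blast
  have "\<forall>\<^sub>F k in sequentially. x k $ i \<noteq> 0" if "i \<in> vec_supp xbar \<union> vec_supp d" for i
  proof (cases "xbar $ i = 0")
    case False
    then show ?thesis
      using tendsto_imp_eventually_ne[OF tendsto_vec_nth[OF lim(1)]] by blast
  next
    case True
    with that have "d $ i \<noteq> 0"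
      by (auto simp: vec_supp_def)
    then have "\<forall>\<^sub>F k in sequentially. (lam k *\<^sub>R (x k - xbar)) $ i \<noteq> 0"
      using tendsto_imp_eventually_ne[OF tendsto_vec_nth[OF lim(2)]] by blast
    \<comment> \<open>Since \<open>xbar $ i = 0\<close>, this coordinate is
      \<open>lam k * x k $ i\<close>, and a nonzero product has nonzero factors.\<close>
    then show ?thesis
      by eventually_elim (use True in auto)
  qed
  \<comment> \<open>There are only finitely many indices, so a single \<open>k\<close> serves them
    all.\<close>
  then have "\<forall>\<^sub>F k in sequentially. \<forall>i \<in> vec_supp xbar \<union> vec_supp d. x k $ i \<noteq> 0"
    by (intro eventually_ball_finite) auto
  then obtain k where "\<forall>i \<in> vec_supp xbar \<union> vec_supp d. x k $ i \<noteq> 0"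
    using eventually_happens trivial_limit_sequentially by blast
  then have "vec_supp xbar \<union> vec_supp d \<subseteq> vec_supp (x k)"
    by (auto simp: vec_supp_def)
  then have "card (vec_supp xbar \<union> vec_supp d) \<le> l0_norm (x k)"
    unfolding l0_norm_def by (intro card_mono) auto
  also have "\<dots> \<le> s"
    using x by (simp add: sparse_set_def)
  finally show ?thesis .
qed

lemma l0_norm_le_of_card_Un_supp:
  fixes x d :: "real ^ 'n"
  assumes "card (vec_supp x \<union> vec_supp d) \<le> s"
  shows "l0_norm d \<le> s" and "l0_norm (x + \<mu> *\<^sub>R d) \<le> s"
proof -
  have bound: "l0_norm y \<le> s" if "vec_supp y \<subseteq> vec_supp x \<union> vec_supp d" for y :: "real ^ 'n"
    unfolding l0_norm_def using card_mono[OF _ that] assms by simp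
  show "l0_norm d \<le> s" and "l0_norm (x + \<mu> *\<^sub>R d) \<le> s"
    by (rule bound, auto simp: vec_supp_def)+
qed

lemma bouligand_tangent_cone_sparse_set:
  fixes xbar :: "real ^ 'n"
  shows "bouligand_tangent_cone (sparse_set s) xbar
    = {d. card (vec_supp xbar \<union> vec_supp d) \<le> s}"
proof (intro equalityI subsetI CollectI)
  fix d assume "d \<in> {d. card (vec_supp xbar \<union> vec_supp d) \<le> s}"
  then show "d \<in> bouligand_tangent_cone (sparse_set s) xbar"
    by (intro mem_bouligand_tangent_coneI) (simp add: sparse_set_def l0_norm_le_of_card_Un_supp)
qed (rule bouligand_tangent_cone_sparse_set_supp)

text \<open>For the forward inclusion, a line through \<open>x\<close> that stays sparse makes
  \<open>d\<close> tangent, and the bound for tangent vectors applies. This avoids choosing a \<mu>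
  for which no coordinate of \<open>x + \<mu> *\<^sub>R d\<close> cancels.\<close>

lemma l0_norm_line_le_eq:
  fixes x :: "real ^ 'n"
  shows "{d. l0_norm d \<le> s \<and> (\<forall>\<mu>. l0_norm (x + \<mu> *\<^sub>R d) \<le> s)}
    = {d. card (vec_supp x \<union> vec_supp d) \<le> s}"
proof (intro equalityI subsetI)
  fix d assume "d \<in> {d. l0_norm d \<le> s \<and> (\<forall>\<mu>. l0_norm (x + \<mu> *\<^sub>R d) \<le> s)}"
  then have "d \<in> bouligand_tangent_cone (sparse_set s) x"
    by (intro mem_bouligand_tangent_coneI) (simp add: sparse_set_def)
  then show "d \<in> {d. card (vec_supp x \<union> vec_supp d) \<le> s}"
    by (simp add: bouligand_tangent_cone_sparse_set)
qed (simp add: l0_norm_le_of_card_Un_supp)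

lemma Union_span_axis_eq:
  fixes \<Gamma> :: "'n::finite set"
  shows "(\<Union>\<Upsilon> \<in> {\<Upsilon>. \<Gamma> \<subseteq> \<Upsilon> \<and> card \<Upsilon> \<le> s}. span {axis i (1::real) | i. i \<in> \<Upsilon>})
    = {d. card (\<Gamma> \<union> vec_supp d) \<le> s}"
proof (intro equalityI subsetI)
  fix d assume "d \<in> (\<Union>\<Upsilon> \<in> {\<Upsilon>. \<Gamma> \<subseteq> \<Upsilon> \<and> card \<Upsilon> \<le> s}. span {axis i (1::real) | i. i \<in> \<Upsilon>})"
  then obtain \<Upsilon> where "\<Gamma> \<union> vec_supp d \<subseteq> \<Upsilon>" "card \<Upsilon> \<le> s"
    unfolding span_axis_eq by auto
  then show "d \<in> {d. card (\<Gamma> \<union> vec_supp d) \<le> s}"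
    using card_mono[of \<Upsilon> "\<Gamma> \<union> vec_supp d"] by simp
next
  fix d assume "d \<in> {d. card (\<Gamma> \<union> vec_supp d) \<le> s}"
  then show "d \<in> (\<Union>\<Upsilon> \<in> {\<Upsilon>. \<Gamma> \<subseteq> \<Upsilon> \<and> card \<Upsilon> \<le> s}. span {axis i (1::real) | i. i \<in> \<Upsilon>})"
    \<comment> \<open>The smallest index set that contains \<Gamma> and supports
      \<open>d\<close>.\<close>
    unfolding span_axis_eq by (intro UN_I[of "\<Gamma> \<union> vec_supp d"]) auto
qed

text \<open>The cardinality bound makes the whole \<open>i\<close>-th axis tangent, and testing
  \<open>d\<close> against both of its directions leaves only zero. Both cases of the normal cone
  use this.\<close>

lemma bouligand_normal_cone_coord_eq_0:
  fixes xbar d :: "real ^ 'n"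
  assumes "d \<in> bouligand_normal_cone (sparse_set s) xbar"
    and "card (insert i (vec_supp xbar)) \<le> s"
  shows "d $ i = 0"
proof -
  have "axis i c \<in> bouligand_tangent_cone (sparse_set s) xbar" for c
  proof -
    have "vec_supp xbar \<union> vec_supp (axis i c) \<subseteq> insert i (vec_supp xbar)"
      by (auto simp: vec_supp_def axis_def)
    from card_mono[OF _ this] assms(2) show ?thesis
      by (simp add: bouligand_tangent_cone_sparse_set)
  qed
  then have "d \<bullet> axis i c \<le> 0" for c
    using assms(1) by (auto simp: bouligand_normal_cone_def)
  from this[of 1] this[of "-1"] show ?thesis
    by (simp add: inner_axis)
qed

lemma bouligand_normal_cone_sparse_set_eq:
  fixes xbar :: "real ^ 'n"
  assumes "card (vec_supp xbar) = s"
  shows "bouligand_normal_cone (sparse_set s) xbar = {d. \<forall>i\<in>vec_supp xbar. d $ i = 0}"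
proof (intro equalityI subsetI CollectI ballI)
  fix d i assume "d \<in> bouligand_normal_cone (sparse_set s) xbar" "i \<in> vec_supp xbar"
  then show "d $ i = 0"
    using assms by (intro bouligand_normal_cone_coord_eq_0) (auto simp: insert_absorb)
next
  fix d assume d: "d \<in> {d :: real ^ 'n. \<forall>i\<in>vec_supp xbar. d $ i = 0}"
  have "d \<bullet> z \<le> 0" if "z \<in> bouligand_tangent_cone (sparse_set s) xbar" for z
  proof -
    have "card (vec_supp xbar \<union> vec_supp z) \<le> card (vec_supp xbar)"
      using that assms by (simp add: bouligand_tangent_cone_sparse_set)
    \<comment> \<open>The support of \<open>xbar\<close> already has \<open>s\<close> elements, so a
      tangent \<open>z\<close> cannot leave it, and \<open>d\<close> vanishes there.\<close>
    then have "vec_supp xbar = vec_supp xbar \<union> vec_supp z"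
      by (intro card_seteq) auto
    then have "d $ i * z $ i = 0" for i
      using d by (auto simp: vec_supp_def)
    then show ?thesis
      by (simp only: inner_vec_def inner_real_def sum.neutral_const order_refl)
  qed
  then show "d \<in> bouligand_normal_cone (sparse_set s) xbar"
    by (simp add: bouligand_normal_cone_def)
qed

lemma bouligand_normal_cone_sparse_set_less:
  fixes xbar :: "real ^ 'n"
  assumes "card (vec_supp xbar) < s"
  shows "bouligand_normal_cone (sparse_set s) xbar = {0}"
proof -
  have "d = 0" if "d \<in> bouligand_normal_cone (sparse_set s) xbar" for d
    unfolding vec_eq_iff
    \<comment> \<open>With fewer than \<open>s\<close> indices in the support there is room for any
      further \<open>i\<close>, so every coordinate of \<open>d\<close> is zero.\<close>
    using bouligand_normal_cone_coord_eq_0[OF that] assms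
    by (auto simp: card_insert_if)
  then show ?thesis
    by (auto simp: bouligand_normal_cone_def)
qed

theorem theorem2p1:
  fixes xbar :: "real ^ 'n" and s :: nat and \<Gamma> :: "'n set"
  assumes "0 < s" and "s < CARD('n)"
    and "xbar \<in> sparse_set s"
    and "\<Gamma> = vec_supp xbar"
  shows "bouligand_tangent_cone (sparse_set s) xbar
           = {d. l0_norm d \<le> s \<and> (\<forall>\<mu>::real. l0_norm (xbar + \<mu> *\<^sub>R d) \<le> s)}
       \<and> {d. l0_norm d \<le> s \<and> (\<forall>\<mu>::real. l0_norm (xbar + \<mu> *\<^sub>R d) \<le> s)}
           = (\<Union>\<Upsilon> \<in> {\<Upsilon> :: 'n set. \<Gamma> \<subseteq> \<Upsilon> \<and> card \<Upsilon> \<le> s}. span {axis i (1::real) | i. i \<in> \<Upsilon>})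
       \<and> (card \<Gamma> = s \<longrightarrow>
             bouligand_normal_cone (sparse_set s) xbar = {d. \<forall>i\<in>\<Gamma>. d $ i = 0}
           \<and> {d :: real ^ 'n. \<forall>i\<in>\<Gamma>. d $ i = 0} = span {axis i (1::real) | i. i \<notin> \<Gamma>})
       \<and> (card \<Gamma> < s \<longrightarrow> bouligand_normal_cone (sparse_set s) xbar = {0})"
proof (intro conjI impI)
  show "{d :: real ^ 'n. \<forall>i\<in>\<Gamma>. d $ i = 0} = span {axis i (1::real) | i. i \<notin> \<Gamma>}"
    using span_axis_eq[of "- \<Gamma>"] by (auto simp: vec_supp_def)
\<comment> \<open>The tangent cone, the set of sparse lines and the union of spans all rewrite to
  the same bound on the cardinality of a union of supports.\<close>
qed (use assms in \<open>simp_all only: bouligand_tangent_cone_sparse_set l0_norm_line_le_eq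
      Union_span_axis_eq bouligand_normal_cone_sparse_set_eq bouligand_normal_cone_sparse_set_less\<close>)

end
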